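(* For every $n\geq 1$, $\gamma'_{MB}(P_2\square P_n)=n$.
   Context: $P_k$ is the path on $k$ vertices and $\square$ the Cartesian product, so $P_2\square P_n$ is the $2\times n$ grid. In the Maker–Breaker domination game on a graph $G$, two players, Dominator and Staller, alternately claim previously unclaimed vertices of $G$. Dominator wins if the set of vertices he claims becomes a dominating set of $G$ (every vertex not in it has a neighbour in it); Staller wins if she claims some vertex together with all of its neighbours. In the $S$-game Staller moves first. $\gamma'_{MB}(G)$ is the minimum number of moves Dominator needs to win the $S$-game on $G$ against optimal play by Staller (who tries to postpone his win). *)

theory Defs
  imports Main "HOL-Library.Extended_Nat"
begin

record 'a graph =
  verts :: "'a set"
  adj :: "'a \<Rightarrow> 'a \<Rightarrow> bool"

definition simple_graph :: "'a graph \<Rightarrow> bool" where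
  "simple_graph G \<longleftrightarrow> finite (verts G)
     \<and> (\<forall>u v. adj G u v \<longrightarrow> u \<in> verts G \<and> v \<in> verts G \<and> u \<noteq> v \<and> adj G v u)"

definition path_graph :: "nat \<Rightarrow> nat graph" where
  "path_graph n = \<lparr>verts = {..<n},
     adj = (\<lambda>i j. i < n \<and> j < n \<and> (j = Suc i \<or> i = Suc j))\<rparr>"

definition cartesian_product :: "'a graph \<Rightarrow> 'b graph \<Rightarrow> ('a \<times> 'b) graph" where
  "cartesian_product G H = \<lparr>verts = verts G \<times> verts H,
     adj = (\<lambda>(g, h) (g', h').
        (g = g' \<and> g \<in> verts G \<and> adj H h h') \<or> (adj G g g' \<and> h = h' \<and> h \<in> verts H))\<rparr>"

lemma simple_graph_path_graph: "simple_graph (path_graph n)"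
  by (auto simp: simple_graph_def path_graph_def)

lemma simple_graph_cartesian_product:
  "simple_graph G \<Longrightarrow> simple_graph H \<Longrightarrow> simple_graph (cartesian_product G H)"
  unfolding simple_graph_def cartesian_product_def by auto

definition dominating_set :: "'a graph \<Rightarrow> 'a set \<Rightarrow> bool" where
  "dominating_set G D \<longleftrightarrow>
     D \<subseteq> verts G \<and> (\<forall>v \<in> verts G - D. \<exists>u \<in> D. adj G v u)"

definition closed_neighbourhood :: "'a graph \<Rightarrow> 'a \<Rightarrow> 'a set" where
  "closed_neighbourhood G v = insert v {u \<in> verts G. adj G v u}"

definition staller_has_won :: "'a graph \<Rightarrow> 'a set \<Rightarrow> bool" where
  "staller_has_won G S \<longleftrightarrow> (\<exists>v \<in> verts G. closed_neighbourhood G v \<subseteq> S)"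

definition unclaimed :: "'a graph \<Rightarrow> 'a set \<Rightarrow> 'a set \<Rightarrow> 'a set" where
  "unclaimed G D S = verts G - (D \<union> S)"

text \<open>
  \<open>dominator_forces G k D S\<close>: from the position in which Dominator has claimed \<open>D\<close>,
  Staller has claimed \<open>S\<close> and Staller is to move, Dominator can force a win while making
  at most \<open>k\<close> further moves of his own (Staller's moves are not counted).
  The condition that an unclaimed vertex exists makes a position in which the board is
  exhausted without Dominator having won count as not won, rather than vacuously won.
\<close>

fun dominator_forces :: "'a graph \<Rightarrow> nat \<Rightarrow> 'a set \<Rightarrow> 'a set \<Rightarrow> bool" where
  "dominator_forces G 0 D S \<longleftrightarrow> dominating_set G D"
| "dominator_forces G (Suc k) D S \<longleftrightarrow> dominating_set G D \<or>
     (unclaimed G D S \<noteq> {} \<and>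
      (\<forall>s \<in> unclaimed G D S. \<not> staller_has_won G (insert s S) \<and>
         (\<exists>d \<in> unclaimed G D (insert s S).
            dominator_forces G k (insert d D) (insert s S))))"

text \<open>
  The value is \<open>\<infinity>\<close> (the infimum of the empty set) if Dominator cannot win
  when Staller moves first.
\<close>

definition gamma_MB' :: "'a graph \<Rightarrow> enat" where
  "gamma_MB' G = Inf {enat k | k. dominator_forces G k {} {}}"

end

theory Submission imports Defs begin

text \<open>Upper bound: whenever Staller takes a vertex, Dominator takes the other vertex of its column;
  after \<open>n\<close> replies he owns a vertex of every column, and Staller never owns a whole column.

  Lower bound: a position is viewed as the hypergraph of the closed neighbourhoods that Dominator has
  not yet hit, each reduced to the vertices Staller still needs. Staller works through the grid from
  left to right. She always attacks in such a way that Dominator either loses outright or makes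
  as many moves as there are columns settled by the exchange, so that he never gains
  a move and needs \<open>n\<close> of them.\<close>

section \<open>Delaying strategies in terms of undominated closed neighbourhoods\<close>

text \<open>\<open>X\<close> only has to cover the vertices that Staller still needs. Thus
  \<open>{}\<close> means that she has already won, a singleton is an immediate threat, and
  \<open>UNIV\<close> says just that some vertex is undominated.\<close>

definition live :: "'a graph \<Rightarrow> 'a set \<Rightarrow> 'a set \<Rightarrow> 'a set \<Rightarrow> bool" where
  "live G D S X \<longleftrightarrow>
     (\<exists>v \<in> verts G. closed_neighbourhood G v \<inter> D = {} \<and> closed_neighbourhood G v \<subseteq> S \<union> X)"

text \<open>With Staller to move, Dominator needs at least \<open>k\<close> further moves. A
  position already won by Staller satisfies this for every \<open>k\<close>, so outright wins and
  mere delays share one notion.\<close>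

fun delays :: "'a graph \<Rightarrow> nat \<Rightarrow> 'a set \<Rightarrow> 'a set \<Rightarrow> bool" where
  "delays G 0 D S \<longleftrightarrow> True"
| "delays G (Suc k) D S \<longleftrightarrow> live G D S UNIV \<and>
     (\<exists>s. \<forall>d. d \<notin> insert s S \<longrightarrow> delays G k (insert d D) (insert s S))"

declare delays.simps(2) [simp del]

lemma live_mono: "live G D S X \<Longrightarrow> X \<subseteq> Y \<Longrightarrow> live G D S Y"
  unfolding live_def by blast

text \<open>Carries a target through one round: a reply outside \<open>S\<close> and
  \<open>X\<close> misses the whole closed neighbourhood, and \<open>s\<close> may be struck off the
  vertices still needed.\<close>

lemma live_step:
  assumes "live G D S X" "d \<notin> insert s S" "d \<notin> X" "X \<subseteq> insert s Y"
  shows "live G (insert d D) (insert s S) Y"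
proof -
  from assms(1) obtain v where v: "v \<in> verts G" "closed_neighbourhood G v \<inter> D = {}"
    "closed_neighbourhood G v \<subseteq> S \<union> X" unfolding live_def by blast
  have "closed_neighbourhood G v \<inter> insert d D = {}"
    "closed_neighbourhood G v \<subseteq> insert s S \<union> Y" using v assms(2-4) by auto
  then show ?thesis using v(1) unfolding live_def by blast
qed

lemma live_not_dominating: "live G D S X \<Longrightarrow> \<not> dominating_set G D"
  unfolding live_def dominating_set_def closed_neighbourhood_def by fastforce

lemma delays_Suc_imp: "delays G (Suc k) D S \<Longrightarrow> delays G k D S"
proof (induction k arbitrary: D S)
  case (Suc k)
  then show ?case by (simp only: delays.simps(2)) blast
qed simp

lemma delays_antimono: "delays G k D S \<Longrightarrow> j \<le> k \<Longrightarrow> delays G j D S"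
  by (rule inc_induct[of j k]) (auto intro: delays_Suc_imp)

lemma delays_stepI:
  assumes "live G D S X"
    and "\<And>d. d \<notin> insert s S \<Longrightarrow> delays G k (insert d D) (insert s S)"
  shows "delays G (Suc k) D S"
  using assms live_mono[OF assms(1) subset_UNIV] by (auto simp: delays.simps(2) intro!: exI[of _ s])

lemma delays_empty: "live G D S {} \<Longrightarrow> delays G k D S"
proof (induction k arbitrary: D S)
  case (Suc k)
  show ?case
  proof (rule delays_stepI[OF Suc.prems])
    \<comment> \<open>\<open>undefined\<close> is an arbitrary move: Staller's neighbourhood is
      already complete.\<close>
    fix d assume "d \<notin> insert undefined S"
    then show "delays G k (insert d D) (insert undefined S)"
      by (intro Suc.IH live_step[OF Suc.prems]) auto
  qed
qed simp

lemma delays_single: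
  assumes "live G D S {x}" shows "delays G k D S"
proof (cases k)
  case (Suc j)
  show ?thesis unfolding Suc
  proof (rule delays_stepI[OF assms, where s = x])
    fix d assume "d \<notin> insert x S"
    then show "delays G j (insert d D) (insert x S)"
      by (intro delays_empty live_step[OF assms]) auto
  qed
qed simp

text \<open>Taking \<open>s\<close> threatens \<open>x\<close>; any reply other than
  \<open>x\<close> loses to \<open>x\<close> at once, so one reply remains to be examined.\<close>

lemma delays_forced:
  assumes "live G D S {s, x}" "x \<notin> insert s S \<Longrightarrow> delays G k (insert x D) (insert s S)"
  shows "delays G (Suc k) D S"
proof (rule delays_stepI[OF assms(1), where s = s])
  fix d assume d: "d \<notin> insert s S"
  show "delays G k (insert d D) (insert s S)"
  proof (cases "d = x")
    case True
    then show ?thesis using assms(2) d by simp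
  next
    case False
    then show ?thesis using d by (intro delays_single[where x = x] live_step[OF assms(1)]) auto
  qed
qed

text \<open>Double threat: \<open>x\<close> and \<open>y\<close> cannot both be answered, so the
  bound holds for every \<open>k\<close>.\<close>

lemma delays_fork:
  assumes "live G D S {s, x}" "live G D S {s, y}" "x \<noteq> y"
  shows "delays G k D S"
proof (cases k)
  case (Suc j)
  show ?thesis unfolding Suc
  proof (rule delays_forced[OF assms(1)])
    assume "x \<notin> insert s S"
    then show "delays G j (insert x D) (insert s S)"
      using assms(3) by (intro delays_single[where x = y] live_step[OF assms(2)]) auto
  qed
qed simp

text \<open>Once Staller has \<open>s\<close>, no single reply meets both targets.\<close>

lemma delays_disjoint:
  assumes "live G D S X" "live G D S Y" "X \<inter> Y \<subseteq> {s}"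
  shows "delays G (Suc (Suc 0)) D S"
proof (rule delays_stepI[OF assms(1), where s = s])
  fix d assume d: "d \<notin> insert s S"
  have "live G (insert d D) (insert s S) UNIV"
  proof (cases "d \<in> X")
    case True
    then show ?thesis using d assms(3) by (intro live_step[OF assms(2)]) auto
  next
    case False
    then show ?thesis using d by (intro live_step[OF assms(1)]) auto
  qed
  then show "delays G (Suc 0) (insert d D) (insert s S)" by (simp add: delays.simps(2))
qed

text \<open>Staller's moves in \<^const>\<open>delays\<close> need not be legal: a move on a claimed vertex or off the
  board is a pass, and an arbitrary legal move serves her at least as well. Hence the weak
  inclusion between the two sets of Staller's vertices.\<close>

lemma delays_not_forces:
  assumes "delays G (Suc k) D T" "T \<inter> verts G \<subseteq> D \<union> S"
  shows "\<not> dominator_forces G k D S"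
  using assms
proof (induction k arbitrary: D S T)
  \<comment> \<open>The extra unit in \<open>Suc k\<close> is used here:
    \<open>delays G (Suc 0)\<close> makes \<open>D\<close> non-dominating, whereas
    \<open>delays G 0\<close> says nothing.\<close>
  case 0
  then show ?case using live_not_dominating by (fastforce simp: delays.simps(2))
next
  case (Suc k)
  from Suc.prems(1) obtain s where nd: "\<not> dominating_set G D"
    and s: "\<And>d. d \<notin> insert s T \<Longrightarrow> delays G (Suc k) (insert d D) (insert s T)"
    by (metis delays.simps(2) live_not_dominating)
  show ?case
  proof (cases "unclaimed G D S = {}")
    case True
    then show ?thesis using nd by simp
  next
    case False
    define t where "t = (if s \<in> unclaimed G D S then s else (SOME t. t \<in> unclaimed G D S))"
    have t: "t \<in> unclaimed G D S"
      using False by (auto simp: t_def some_in_eq)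
    have sub: "insert s T \<inter> verts G \<subseteq> D \<union> insert t S"
      using Suc.prems(2) by (auto simp: t_def unclaimed_def)
    have "\<not> dominator_forces G k (insert d D) (insert t S)"
      if d: "d \<in> unclaimed G D (insert t S)" for d
    proof (rule Suc.IH)
      show "delays G (Suc k) (insert d D) (insert s T)"
        using d sub by (intro s) (auto simp: unclaimed_def)
      show "insert s T \<inter> verts G \<subseteq> insert d D \<union> insert t S" using sub by auto
    qed
    then show ?thesis using nd t by auto
  qed
qed

text \<open>After Staller takes \<open>z\<close>, the pairs \<open>{p, x}\<close>, \<open>{x, y}\<close>, \<open>{y, q}\<close> form a path of
  threats, so that every reply other than \<open>x\<close> and \<open>y\<close> runs into a double threat.\<close>

lemma delays_path:
  assumes xy: "live G D S {x, y}" and xp: "live G D S {x, z, p}" and yq: "live G D S {y, z, q}"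
    and dist: "distinct [x, y, z, p, q]"
    and x: "x \<notin> S \<Longrightarrow> delays G k (insert x D) (insert z S)"
    and y: "y \<notin> S \<Longrightarrow> delays G k (insert y D) (insert z S)"
  shows "delays G (Suc k) D S"
proof (rule delays_stepI[OF xy, where s = z])
  fix d assume d: "d \<notin> insert z S"
  consider "d = x" | "d = y" | "d \<noteq> x" "d \<noteq> y" "d \<noteq> p" | "d \<noteq> x" "d \<noteq> y" "d = p" by blast
  then show "delays G k (insert d D) (insert z S)"
  proof cases
    case 3
    with d dist show ?thesis
      by (intro delays_fork[of _ _ _ x y p] live_step[OF xy] live_step[OF xp]) auto
  next
    case 4
    with d dist show ?thesis
      by (intro delays_fork[of _ _ _ y x q] live_step[OF xy] live_step[OF yq]) auto
  qed (use x y d in auto)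
qed

text \<open>Taking \<open>s\<close> leaves the pairs \<open>{x, y}\<close> and
  \<open>{p, q}\<close>, linked by \<open>{y, p, t}\<close>. A reply outside these five vertices
  loses: \<open>y\<close> forces \<open>x\<close>, then \<open>p\<close> threatens both
  \<open>q\<close> and \<open>t\<close>. A reply \<open>p\<close>, \<open>q\<close> or
  \<open>t\<close> permits one or two forced exchanges, leading to the position in the hypothesis of
  that name.\<close>

lemma delays_wedge:
  assumes xy: "live G D S {s, x, y}" and pq: "live G D S {s, p, q}" and ypt: "live G D S {s, y, p, t}"
    and dist: "distinct [s, x, y, p, q, t]"
    and x: "delays G (Suc (Suc k)) (insert x D) (insert s S)"
    and y: "delays G (Suc (Suc k)) (insert y D) (insert s S)"
    and p: "delays G (Suc k) (insert y (insert p D)) (insert x (insert s S))"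
    and q: "delays G k (insert p (insert x (insert q D))) (insert t (insert y (insert s S)))"
    and t: "delays G k (insert y (insert p (insert t D))) (insert x (insert q (insert s S)))"
  shows "delays G (Suc (Suc (Suc k))) D S"
proof (rule delays_stepI[OF xy, where s = s])
  fix d assume d: "d \<notin> insert s S"
  let ?S = "insert s S"
  consider "d = x" | "d = y" | "d = p" | "d = q" | "d = t" | "d \<notin> {x, y, p, q, t}" by blast
  then show "delays G (Suc (Suc k)) (insert d D) ?S"
  proof cases
    case 3
    have "live G (insert d D) ?S {x, y}" using d dist 3 by (intro live_step[OF xy]) auto
    then show ?thesis using p 3 by (auto intro: delays_forced[of _ _ _ x y "Suc k"])
  next
    case 4
    have l: "live G (insert d D) ?S {y, x}" "live G (insert d D) ?S {y, p, t}"
      by (rule live_step[OF xy d] live_step[OF ypt d]; use 4 dist in force)+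
    show ?thesis
    proof (rule delays_forced[OF l(1)], rule delays_forced[of _ _ _ t p])
      assume "x \<notin> insert y ?S"
      then show "live G (insert x (insert d D)) (insert y ?S) {t, p}"
        using dist by (intro live_step[OF l(2)]) auto
    qed (use q 4 in auto)
  next
    case 5
    have l: "live G (insert d D) ?S {q, p}" "live G (insert d D) ?S {x, y}"
      by (rule live_step[OF pq d] live_step[OF xy d]; use 5 dist in force)+
    show ?thesis
    proof (rule delays_forced[OF l(1)], rule delays_forced[of _ _ _ x y])
      assume "p \<notin> insert q ?S"
      then show "live G (insert p (insert d D)) (insert q ?S) {x, y}"
        using dist by (intro live_step[OF l(2)]) auto
    qed (use t 5 in auto)
  next
    case 6
    have l: "live G (insert d D) ?S {y, x}" "live G (insert d D) ?S {p, q}"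
      "live G (insert d D) ?S {y, p, t}"
      using live_step[OF xy d, of "{y, x}"] live_step[OF pq d, of "{p, q}"]
        live_step[OF ypt d, of "{y, p, t}"] 6 d by auto
    show ?thesis
    proof (rule delays_forced[OF l(1)], rule delays_fork[of _ _ _ p q t])
      assume x': "x \<notin> insert y ?S"
      show "live G (insert x (insert d D)) (insert y ?S) {p, q}"
        using x' dist by (intro live_step[OF l(2)]) auto
      show "live G (insert x (insert d D)) (insert y ?S) {p, t}"
        using x' dist by (intro live_step[OF l(3)]) auto
    qed (use dist in auto)
  qed (use x y in auto)
qed

section \<open>Targets on the grid and the advancing front\<close>

abbreviation grid :: "nat \<Rightarrow> (nat \<times> nat) graph" where
  "grid n \<equiv> cartesian_product (path_graph 2) (path_graph n)"

lemma verts_grid: "verts (grid n) = {..<2} \<times> {..<n}"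
  by (simp add: cartesian_product_def path_graph_def)

lemma closed_neighbourhood_grid:
  assumes "a < 2" "j < n" "b = 1 - a"
  shows "closed_neighbourhood (grid n) (a, j) =
    {(a, j), (b, j)} \<union> {(a, i) | i. i < n \<and> (i = Suc j \<or> j = Suc i)}"
  using assms
  by (auto simp: closed_neighbourhood_def cartesian_product_def path_graph_def)

text \<open>The two horizontal neighbours are treated differently because play runs from left to
  right: only the left one may already be Staller's.\<close>

lemma live_gridI:
  assumes "{a, b} = {0, 1}" "j < n" "(a, j) \<notin> D" "(b, j) \<notin> D" "{(a, j), (b, j)} \<subseteq> X"
    and "\<And>i. j = Suc i \<Longrightarrow> (a, i) \<notin> D \<and> (a, i) \<in> S \<union> X"
    and "Suc j < n \<Longrightarrow> (a, Suc j) \<notin> D \<and> (a, Suc j) \<in> X"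
  shows "live (grid n) D S X"
proof -
  have ab: "a < 2" "b = 1 - a" using assms(1) by (auto simp: doubleton_eq_iff)
  have "x \<notin> D \<and> x \<in> S \<union> X" if "x \<in> closed_neighbourhood (grid n) (a, j)" for x
    using that assms(3-7) unfolding closed_neighbourhood_grid[OF ab(1) assms(2) ab(2)] by blast
  moreover have "(a, j) \<in> verts (grid n)" using ab(1) assms(2) by (simp add: verts_grid)
  ultimately show ?thesis unfolding live_def by blast
qed

text \<open>The assumption \<open>shield\<close> cuts the vertex of row \<open>r\<close> in column \<open>c\<close> off from the left: it can
  only be dominated from the columns that remain. The other vertex of column \<open>c\<close> may already be
  dominated. There is nothing to assume when \<open>c = 0\<close>.\<close>

locale grid_front =
  fixes c r r' :: nat and D S :: "(nat \<times> nat) set"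
  assumes rows: "{r, r'} = {0, 1}"
    and front: "\<And>a i. (a, i) \<in> D \<Longrightarrow> i < c"
    and shield: "\<And>i. c = Suc i \<Longrightarrow> (r, i) \<in> S - D"
begin

abbreviation "u0 \<equiv> (r, c)"
abbreviation "u1 \<equiv> (r, Suc c)"
abbreviation "u2 \<equiv> (r, Suc (Suc c))"
abbreviation "u3 \<equiv> (r, Suc (Suc (Suc c)))"
abbreviation "v0 \<equiv> (r', c)"
abbreviation "v1 \<equiv> (r', Suc c)"
abbreviation "v2 \<equiv> (r', Suc (Suc c))"
abbreviation "v3 \<equiv> (r', Suc (Suc (Suc c)))"

lemma rows_swap: "{r', r} = {0, 1}"
  using rows by (simp add: insert_commute)

lemma rows_neq: "r \<noteq> r'" "r' \<noteq> r"
  using rows by (simp_all add: doubleton_eq_iff) linarith+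

lemma unplayed: "c \<le> i \<Longrightarrow> (a, i) \<notin> D"
  using front[of a i] by auto

lemma front_bound: "c \<le> i \<Longrightarrow> \<forall>p\<in>D. snd p \<le> i"
  by (metis front less_imp_le order.trans prod.collapse)

text \<open>The one target reaching behind the front; \<open>shield\<close> supplies its left
  neighbour. For \<open>v0\<close> there is no analogue, as it may already be dominated.\<close>

lemma live_u0: "c < n \<Longrightarrow> (Suc c < n \<Longrightarrow> u1 \<in> X) \<Longrightarrow> {u0, v0} \<subseteq> X \<Longrightarrow> live (grid n) D S X"
  using shield by (intro live_gridI[OF rows, of c]) (auto simp: unplayed)

lemma live_u1:
  "Suc c < n \<Longrightarrow> (Suc (Suc c) < n \<Longrightarrow> u2 \<in> X) \<Longrightarrow> {u0, u1, v1} \<subseteq> X \<Longrightarrow> live (grid n) D S X"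
  by (intro live_gridI[OF rows, of "Suc c"]) (auto simp: unplayed)

lemma live_v1:
  "Suc c < n \<Longrightarrow> (Suc (Suc c) < n \<Longrightarrow> v2 \<in> X) \<Longrightarrow> {v0, u1, v1} \<subseteq> X \<Longrightarrow> live (grid n) D S X"
  by (intro live_gridI[OF rows_swap, of "Suc c"]) (auto simp: unplayed)

lemma live_u2:
  "Suc (Suc c) < n \<Longrightarrow> (Suc (Suc (Suc c)) < n \<Longrightarrow> u3 \<in> X) \<Longrightarrow> {u1, u2, v2} \<subseteq> X \<Longrightarrow>
    live (grid n) D S X"
  by (intro live_gridI[OF rows, of "Suc (Suc c)"]) (auto simp: unplayed)

lemma live_v2:
  "Suc (Suc c) < n \<Longrightarrow> (Suc (Suc (Suc c)) < n \<Longrightarrow> v3 \<in> X) \<Longrightarrow> {v1, u2, v2} \<subseteq> X \<Longrightarrow>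
    live (grid n) D S X"
  by (intro live_gridI[OF rows_swap, of "Suc (Suc c)"]) (auto simp: unplayed)

section \<open>One move of Dominator per remaining column\<close>

lemma delays_1: "c < n \<Longrightarrow> delays (grid n) (Suc 0) D S"
  using live_u0[where X = UNIV] by (simp add: delays.simps(2))

text \<open>The closed neighbourhoods of \<open>u0\<close>, \<open>u1\<close> and \<open>v1\<close>
  have only \<open>u1\<close> in common, so after Staller takes it no single reply meets all
  three.\<close>

lemma delays_2:
  assumes n: "Suc c < n"
  shows "delays (grid n) (Suc (Suc 0)) D S"
proof -
  have l: "live (grid n) D S {u0, v0, u1}" "live (grid n) D S {u1, u0, v1, u2}"
    "live (grid n) D S {v0, v1, u1, v2}"
    using n by (auto intro: live_u0 live_u1 live_v1)
  show ?thesis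
  proof (rule delays_stepI[OF l(1), where s = u1])
    fix d assume d: "d \<notin> insert u1 S"
    have "d \<notin> {u0, v0, u1} \<or> d \<notin> {u1, u0, v1, u2} \<or> d \<notin> {v0, v1, u1, v2}"
      using rows_neq d by auto
    then have "live (grid n) (insert d D) (insert u1 S) UNIV"
      using live_step[OF l(1) d] live_step[OF l(2) d] live_step[OF l(3) d] by blast
    then show "delays (grid n) (Suc 0) (insert d D) (insert u1 S)" by (simp add: delays.simps(2))
  qed
qed

text \<open>After \<open>u1\<close>, the targets \<open>{u0, v0}\<close>,
  \<open>{u0, v1, u2}\<close>, \<open>{v0, v1, v2}\<close>, \<open>{u2, v2}\<close> remain, the last
  without \<open>u3\<close> because the grid ends. Every reply leaves two of them that share at most
  one vertex, as \<open>delays_disjoint\<close> requires.\<close>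

lemma delays_3:
  assumes n: "n = Suc (Suc (Suc c))"
  shows "delays (grid n) (Suc (Suc (Suc 0))) D S"
proof -
  have lt: "c < n" "Suc c < n" "Suc (Suc c) < n" "\<not> Suc (Suc (Suc c)) < n" using n by auto
  have l: "live (grid n) D S {u1, u0, v0}" "live (grid n) D S {u1, u0, v1, u2}"
    "live (grid n) D S {u1, v0, v1, v2}" "live (grid n) D S {u1, u2, v2}"
    using lt by (auto intro: live_u0 live_u1 live_v1 live_u2)
  show ?thesis
  proof (rule delays_stepI[OF l(1), where s = u1])
    fix d assume d: "d \<notin> insert u1 S"
    note step = live_step[OF _ d]
    consider "d = u0" | "d = v0" | "d = u2" | "d = v2" | "d \<notin> {u0, v0, u2, v2}" by blast
    then show "delays (grid n) (Suc (Suc 0)) (insert d D) (insert u1 S)"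
    proof cases
      case 1
      then show ?thesis using rows_neq
        by (intro delays_disjoint[OF step[OF l(3), of "{v0, v1, v2}"]
            step[OF l(4), of "{u2, v2}"], of v2]) auto
    next
      case 2
      then show ?thesis using rows_neq
        by (intro delays_disjoint[OF step[OF l(2), of "{u0, v1, u2}"]
            step[OF l(4), of "{u2, v2}"], of u2]) auto
    next
      case 3
      then show ?thesis using rows_neq
        by (intro delays_disjoint[OF step[OF l(1), of "{u0, v0}"]
            step[OF l(3), of "{v0, v1, v2}"], of v0]) auto
    next
      case 4
      then show ?thesis using rows_neq
        by (intro delays_disjoint[OF step[OF l(1), of "{u0, v0}"]
            step[OF l(2), of "{u0, v1, u2}"], of u0]) auto
    next
      case 5
      then show ?thesis using rows_neq d
        by (intro delays_disjoint[OF step[OF l(1), of "{u0, v0}"]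
            step[OF l(4), of "{u2, v2}"], of u0]) auto
    qed
  qed
qed

text \<open>Staller takes \<open>u1\<close>. After a reply in columns \<open>c\<close> to \<open>c + 3\<close>, threats let her move the front by
  \<open>j\<close> columns while Dominator makes \<open>j\<close> moves in total, with \<open>2 \<le> j \<le> 4\<close>, unless he loses to a
  double threat; any other reply always loses to one.\<close>

lemma delays_4:
  assumes n: "n = Suc (Suc (Suc (Suc (c + k))))"
    and cont: "\<And>i D' S'. c \<le> i \<Longrightarrow> i < n \<Longrightarrow> \<forall>p\<in>D'. snd p \<le> i \<Longrightarrow>
      (r, i) \<in> S' - D' \<or> (r', i) \<in> S' - D' \<Longrightarrow> delays (grid n) (n - Suc i) D' S'"
  shows "delays (grid n) (Suc (Suc (Suc (Suc k)))) D S"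
proof -
  \<comment> \<open>The front advances by two, three or four columns. Dominator's vertices all lie
    behind it, and a vertex of Staller in the last settled column is the new shield, in either
    row.\<close>
  have cont2: "delays (grid n) (Suc (Suc k)) D' S'"
    if "\<forall>p\<in>D'. snd p \<le> Suc c" "u1 \<in> S' \<and> u1 \<notin> D' \<or> v1 \<in> S' \<and> v1 \<notin> D'" for D' S'
    using cont[of "Suc c" D' S'] that n by simp
  have cont3: "delays (grid n) (Suc k) D' S'"
    if "\<forall>p\<in>D'. snd p \<le> Suc (Suc c)" "u2 \<in> S' \<and> u2 \<notin> D' \<or> v2 \<in> S' \<and> v2 \<notin> D'" for D' S'
    using cont[of "Suc (Suc c)" D' S'] that n by simp
  have cont4: "delays (grid n) k D' S'"
    if "\<forall>p\<in>D'. snd p \<le> Suc (Suc (Suc c))" "u3 \<in> S' \<and> u3 \<notin> D' \<or> v3 \<in> S' \<and> v3 \<notin> D'" for D' S'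
    using cont[of "Suc (Suc (Suc c))" D' S'] that n by simp
  note cont = cont2 cont3 cont4
  have lt: "c < n" "Suc c < n" "Suc (Suc c) < n" using n by auto
  have l: "live (grid n) D S {u1, u0, v0}" "live (grid n) D S {u1, u0, v1, u2}"
    "live (grid n) D S {u1, v0, v1, v2}" "live (grid n) D S {u1, u2, v2, u3}"
    "live (grid n) D S {v1, u2, v2, v3}"
    using lt by (auto intro: live_u0 live_u1 live_v1 live_u2 live_v2)
  show ?thesis
  proof (rule delays_stepI[OF l(1), where s = u1])
    fix d assume d: "d \<notin> insert u1 S"
    let ?D = "insert d D" and ?S = "insert u1 S"
    note step = live_step[OF _ d]
    note facts = rows_neq unplayed front_bound cont
    consider "d = u0" | "d = v0" | "d = v1" | "d = u2" | "d = v2" | "d = u3" | "d = v3"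
      | "d \<notin> {u0, v0, v1, u2, v2, u3, v3}" by blast
    then show "delays (grid n) (Suc (Suc (Suc k))) ?D ?S"
    proof cases
      case 1
      \<comment> \<open>Wedge at \<open>v2\<close>, with pairs \<open>{v0, v1}\<close>,
        \<open>{u2, u3}\<close> and link \<open>{v1, u2, v3}\<close>; the reply \<open>v0\<close> is
        met by a similar wedge at \<open>u2\<close>.\<close>
      have "live (grid n) ?D ?S {v2, v0, v1}" "live (grid n) ?D ?S {v2, u2, u3}"
        "live (grid n) ?D ?S {v2, v1, u2, v3}"
        using 1 rows_neq step[OF l(3), of "{v2, v0, v1}"] step[OF l(4), of "{v2, u2, u3}"]
          step[OF l(5), of "{v2, v1, u2, v3}"] by auto
      then show ?thesis by (rule delays_wedge) (simp_all add: 1 facts)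
    next
      case 2
      have "live (grid n) ?D ?S {u2, u0, v1}" "live (grid n) ?D ?S {u2, v2, u3}"
        "live (grid n) ?D ?S {u2, v1, v2, v3}"
        using 2 rows_neq step[OF l(2), of "{u2, u0, v1}"] step[OF l(4), of "{u2, v2, u3}"]
          step[OF l(5), of "{u2, v1, v2, v3}"] by auto
      then show ?thesis by (rule delays_wedge) (simp_all add: 2 facts)
    next
      case 3
      \<comment> \<open>\<open>u0\<close> forces \<open>v0\<close>, and \<open>u1\<close> is the
        shield.\<close>
      have "live (grid n) ?D ?S {u0, v0}" using 3 rows_neq by (intro step[OF l(1)]) auto
      then show ?thesis by (rule delays_forced) (simp add: 3 facts)
    next
      case 4
      \<comment> \<open>\<open>v0\<close> forces \<open>u0\<close>, then \<open>v2\<close> forces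
        \<open>v1\<close> and becomes the shield. For the reply \<open>v2\<close>, below,
        \<open>u0\<close> forces \<open>v0\<close> and \<open>u2\<close> forces
        \<open>v1\<close>.\<close>
      have t: "live (grid n) ?D ?S {v0, u0}" using 4 rows_neq by (intro step[OF l(1)]) auto
      have w: "live (grid n) ?D ?S {v0, v1, v2}" using 4 rows_neq by (intro step[OF l(3)]) auto
      show ?thesis
      proof (rule delays_forced[OF t], rule delays_forced[of _ _ _ v2 v1])
        assume "u0 \<notin> insert v0 ?S"
        then show "live (grid n) (insert u0 ?D) (insert v0 ?S) {v2, v1}"
          using rows_neq by (intro live_step[OF w]) auto
      qed (simp add: 4 facts)
    next
      case 5
      have t: "live (grid n) ?D ?S {u0, v0}" using 5 rows_neq by (intro step[OF l(1)]) auto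
      have w: "live (grid n) ?D ?S {u0, v1, u2}" using 5 rows_neq by (intro step[OF l(2)]) auto
      show ?thesis
      proof (rule delays_forced[OF t], rule delays_forced[of _ _ _ u2 v1])
        assume "v0 \<notin> insert u0 ?S"
        then show "live (grid n) (insert v0 ?D) (insert u0 ?S) {u2, v1}"
          using rows_neq by (intro live_step[OF w]) auto
      qed (simp add: 5 facts)
    next
      case 6
      have t: "live (grid n) ?D ?S {u0, v0}" using 6 rows_neq by (intro step[OF l(1)]) auto
      have w: "live (grid n) ?D ?S {u0, v1, u2}" using 6 rows_neq by (intro step[OF l(2)]) auto
      have w': "live (grid n) ?D ?S {v0, v1, v2}" using 6 rows_neq by (intro step[OF l(3)]) auto
      have z: "live (grid n) ?D ?S {v1, u2, v2, v3}" using 6 rows_neq by (intro step[OF l(5)]) auto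
      show ?thesis
      \<comment> \<open>Staller takes \<open>v1\<close>. After either \<open>u0\<close> or
        \<open>v0\<close>, two forced exchanges end with \<open>v3\<close> as the shield.\<close>
      proof (rule delays_path[OF t w w'])
        assume "u0 \<notin> ?S"
        then have d1: "u0 \<notin> insert v1 ?S" using rows_neq by simp
        have w1: "live (grid n) (insert u0 ?D) (insert v1 ?S) {v2, v0}"
          using rows_neq by (intro live_step[OF w' d1]) auto
        have z1: "live (grid n) (insert u0 ?D) (insert v1 ?S) {u2, v2, v3}"
          using rows_neq by (intro live_step[OF z d1]) auto
        show "delays (grid n) (Suc (Suc k)) (insert u0 ?D) (insert v1 ?S)"
        proof (rule delays_forced[OF w1], rule delays_forced[of _ _ _ v3 u2])
          assume "v0 \<notin> insert v2 (insert v1 ?S)"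
          then show "live (grid n) (insert v0 (insert u0 ?D)) (insert v2 (insert v1 ?S)) {v3, u2}"
            using rows_neq by (intro live_step[OF z1]) auto
        qed (simp add: 6 facts)
      next
        assume "v0 \<notin> ?S"
        then have d1: "v0 \<notin> insert v1 ?S" by simp
        have w1: "live (grid n) (insert v0 ?D) (insert v1 ?S) {u2, u0}"
          using rows_neq by (intro live_step[OF w d1]) auto
        have z1: "live (grid n) (insert v0 ?D) (insert v1 ?S) {u2, v2, v3}"
          using rows_neq by (intro live_step[OF z d1]) auto
        show "delays (grid n) (Suc (Suc k)) (insert v0 ?D) (insert v1 ?S)"
        proof (rule delays_forced[OF w1], rule delays_forced[of _ _ _ v3 v2])
          assume "u0 \<notin> insert u2 (insert v1 ?S)"
          then show "live (grid n) (insert u0 (insert v0 ?D)) (insert u2 (insert v1 ?S)) {v3, v2}"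
            using rows_neq by (intro live_step[OF z1]) auto
        qed (simp add: 6 facts)
      qed (simp add: rows_neq)
    next
      case 7
      have t: "live (grid n) ?D ?S {u0, v0}" using 7 rows_neq by (intro step[OF l(1)]) auto
      have w: "live (grid n) ?D ?S {u0, v1, u2}" using 7 rows_neq by (intro step[OF l(2)]) auto
      have z: "live (grid n) ?D ?S {u2, v2, u3}" using 7 rows_neq by (intro step[OF l(4)]) auto
      show ?thesis
      \<comment> \<open>Three forced exchanges: \<open>u0\<close> against \<open>v0\<close>,
        \<open>u2\<close> against \<open>v1\<close>, \<open>u3\<close> against
        \<open>v2\<close>.\<close>
      proof (rule delays_forced[OF t])
        assume d1: "v0 \<notin> insert u0 ?S"
        have w1: "live (grid n) (insert v0 ?D) (insert u0 ?S) {u2, v1}"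
          using rows_neq by (intro live_step[OF w d1]) auto
        have z1: "live (grid n) (insert v0 ?D) (insert u0 ?S) {u2, v2, u3}"
          using rows_neq by (intro live_step[OF z d1]) auto
        show "delays (grid n) (Suc (Suc k)) (insert v0 ?D) (insert u0 ?S)"
        proof (rule delays_forced[OF w1], rule delays_forced[of _ _ _ u3 v2])
          assume "v1 \<notin> insert u2 (insert u0 ?S)"
          then show "live (grid n) (insert v1 (insert v0 ?D)) (insert u2 (insert u0 ?S)) {u3, v2}"
            using rows_neq by (intro live_step[OF z1]) auto
        qed (simp add: 7 facts)
      qed
    next
      case 8
      have t: "live (grid n) ?D ?S {u0, v0}" using 8 d rows_neq by (intro step[OF l(1)]) auto
      have w: "live (grid n) ?D ?S {u0, v1, u2}" using 8 d rows_neq by (intro step[OF l(2)]) auto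
      have w': "live (grid n) ?D ?S {v0, v1, v2}" using 8 d rows_neq by (intro step[OF l(3)]) auto
      have y: "live (grid n) ?D ?S {u2, v2, u3}" using 8 d rows_neq by (intro step[OF l(4)]) auto
      have z: "live (grid n) ?D ?S {v1, u2, v2, v3}" using 8 d rows_neq by (intro step[OF l(5)]) auto
      show ?thesis
      \<comment> \<open>As for \<open>u3\<close>, but now \<open>y\<close> and \<open>z\<close> are
        both live, so the second exchange is replaced by a double threat at \<open>u3\<close> and
        \<open>v3\<close>.\<close>
      proof (rule delays_path[OF t w w'])
        assume "u0 \<notin> ?S"
        then have d1: "u0 \<notin> insert v1 ?S" using rows_neq by simp
        have w1: "live (grid n) (insert u0 ?D) (insert v1 ?S) {v2, v0}"
          using rows_neq by (intro live_step[OF w' d1]) auto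
        have y1: "live (grid n) (insert u0 ?D) (insert v1 ?S) {u2, v2, u3}"
          using rows_neq by (intro live_step[OF y d1]) auto
        have z1: "live (grid n) (insert u0 ?D) (insert v1 ?S) {u2, v2, v3}"
          using rows_neq by (intro live_step[OF z d1]) auto
        show "delays (grid n) (Suc (Suc k)) (insert u0 ?D) (insert v1 ?S)"
        proof (rule delays_forced[OF w1], rule delays_fork)
          assume d2: "v0 \<notin> insert v2 (insert v1 ?S)"
          show "live (grid n) (insert v0 (insert u0 ?D)) (insert v2 (insert v1 ?S)) {u2, u3}"
            using rows_neq by (intro live_step[OF y1 d2]) auto
          show "live (grid n) (insert v0 (insert u0 ?D)) (insert v2 (insert v1 ?S)) {u2, v3}"
            using rows_neq by (intro live_step[OF z1 d2]) auto
        qed (simp add: rows_neq)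
      next
        assume "v0 \<notin> ?S"
        then have d1: "v0 \<notin> insert v1 ?S" by simp
        have w1: "live (grid n) (insert v0 ?D) (insert v1 ?S) {u2, u0}"
          using rows_neq by (intro live_step[OF w d1]) auto
        have y1: "live (grid n) (insert v0 ?D) (insert v1 ?S) {u2, v2, u3}"
          using rows_neq by (intro live_step[OF y d1]) auto
        have z1: "live (grid n) (insert v0 ?D) (insert v1 ?S) {u2, v2, v3}"
          using rows_neq by (intro live_step[OF z d1]) auto
        show "delays (grid n) (Suc (Suc k)) (insert v0 ?D) (insert v1 ?S)"
        proof (rule delays_forced[OF w1], rule delays_fork)
          assume d2: "u0 \<notin> insert u2 (insert v1 ?S)"
          show "live (grid n) (insert u0 (insert v0 ?D)) (insert u2 (insert v1 ?S)) {v2, u3}"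
            using rows_neq by (intro live_step[OF y1 d2]) auto
          show "live (grid n) (insert u0 (insert v0 ?D)) (insert u2 (insert v1 ?S)) {v2, v3}"
            using rows_neq by (intro live_step[OF z1 d2]) auto
        qed (simp add: rows_neq)
      qed (simp add: rows_neq)
    qed
  qed
qed

end

lemma delays_grid:
  assumes "grid_front c r r' D S"
  shows "delays (grid n) (n - c) D S"
  using assms
proof (induction "n - c" arbitrary: c r r' D S rule: less_induct)
  case less
  interpret grid_front c r r' D S by (rule less.prems)
  \<comment> \<open>The row of Staller's vertex in column \<open>i\<close> decides which row plays
    the part of \<open>r\<close> at the new front, so the two rows may swap.\<close>
  have cont: "delays (grid n) (n - Suc i) D' S'"
    if "c \<le> i" "i < n" "\<forall>p\<in>D'. snd p \<le> i" "(r, i) \<in> S' - D' \<or> (r', i) \<in> S' - D'" for i D' S'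
  proof -
    have "grid_front (Suc i) r r' D' S' \<or> grid_front (Suc i) r' r D' S'"
      using that(4)
    proof
      assume "(r, i) \<in> S' - D'"
      then have "grid_front (Suc i) r r' D' S'" using that(3) rows by unfold_locales force+
      then show ?thesis ..
    next
      assume "(r', i) \<in> S' - D'"
      then have "grid_front (Suc i) r' r D' S'"
        using that(3) rows_swap by unfold_locales force+
      then show ?thesis ..
    qed
    moreover have "n - Suc i < n - c" using that(1,2) by simp
    ultimately show ?thesis using less.hyps by blast
  qed
  consider "n - c = 0" | "n - c = Suc 0" | "n - c = Suc (Suc 0)" | "n - c = Suc (Suc (Suc 0))"
    | k where "n - c = Suc (Suc (Suc (Suc k)))"
    by (metis not0_implies_Suc)
  then show ?case
  proof cases
    case 1
    show ?thesis unfolding 1 by simp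
  next
    case 2
    show ?thesis unfolding 2 by (rule delays_1) (use 2 in linarith)
  next
    case 3
    show ?thesis unfolding 3 by (rule delays_2) (use 3 in linarith)
  next
    case 4
    show ?thesis unfolding 4 by (rule delays_3) (use 4 in linarith)
  next
    case (5 k)
    have "n = Suc (Suc (Suc (Suc (c + k))))" using 5 by linarith
    then show ?thesis unfolding 5 by (rule delays_4) (rule cont)
  qed
qed

section \<open>Upper bound by the column pairing\<close>

text \<open>The invariant is that each touched column is split between the players, so row 0 alone
  suffices to count the \<open>k\<close> untouched ones. Each closed neighbourhood contains a full
  column, which Staller never owns; when \<open>k = 0\<close>, Dominator has a vertex in every
  column.\<close>

lemma pairing_forces:
  assumes "D \<inter> S = {}" "D \<union> S \<subseteq> verts (grid n)"
    and "\<And>i. i < n \<Longrightarrow> (0, i) \<in> D \<longleftrightarrow> (1, i) \<in> S"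
    and "\<And>i. i < n \<Longrightarrow> (1, i) \<in> D \<longleftrightarrow> (0, i) \<in> S"
    and "card {i. i < n \<and> (0, i) \<notin> D \<union> S} = k"
  shows "dominator_forces (grid n) k D S"
  using assms
proof (induction k arbitrary: D S)
  case 0
  have "(0, i) \<in> D \<or> (1, i) \<in> D" if "i < n" for i
    using 0(5) 0(4)[OF that] that by auto
  then show ?case
    using 0(2)
    by (auto simp: dominating_set_def cartesian_product_def path_graph_def less_2_cases_iff) blast+
next
  case (Suc k)
  note pair = Suc.prems(3,4)
  have "{i. i < n \<and> (0, i) \<notin> D \<union> S} \<noteq> {}"
    using Suc.prems(5) by (metis card.empty nat.distinct(1))
  then obtain i where "i < n" "(0, i) \<notin> D \<union> S" by blast
  then have "(0, i) \<in> unclaimed (grid n) D S" by (simp add: unclaimed_def verts_grid)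
  then have "unclaimed (grid n) D S \<noteq> {}" by blast
  moreover have "\<not> staller_has_won (grid n) (insert s S) \<and>
      (\<exists>d \<in> unclaimed (grid n) D (insert s S).
        dominator_forces (grid n) k (insert d D) (insert s S))"
    if s: "s \<in> unclaimed (grid n) D S" for s
  proof -
    obtain a i where ai: "s = (a, i)" "a < 2" "i < n" "(a, i) \<notin> D" "(a, i) \<notin> S"
      using s by (auto simp: unclaimed_def verts_grid)
    define d where "d = (1 - a, i)"
    have d: "d \<in> unclaimed (grid n) D (insert s S)"
      using ai pair[OF ai(3)] by (auto simp: d_def unclaimed_def verts_grid less_2_cases_iff)
    have "\<not> closed_neighbourhood (grid n) v \<subseteq> insert s S" if "v \<in> verts (grid n)" for v
    proof
      obtain b j where v: "v = (b, j)" "b < 2" "j < n" using \<open>v \<in> verts (grid n)\<close>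
        by (auto simp: verts_grid)
      assume "closed_neighbourhood (grid n) v \<subseteq> insert s S"
      then have "{(0, j), (1, j)} \<subseteq> insert s S"
        using v closed_neighbourhood_grid[OF v(2,3) refl] by (auto simp: less_2_cases_iff)
      then show False
        using d pair[OF v(3)] Suc.prems(1) ai
        by (auto simp: d_def unclaimed_def less_2_cases_iff)
    qed
    moreover have "dominator_forces (grid n) k (insert d D) (insert s S)"
    proof (rule Suc.IH)
      have "{j. j < n \<and> (0, j) \<notin> insert d D \<union> insert s S} = {j. j < n \<and> (0, j) \<notin> D \<union> S} - {i}"
        using ai by (auto simp: d_def less_2_cases_iff)
      moreover have "(0, i) \<notin> D \<union> S"
        using ai pair[OF ai(3)] by (auto simp: less_2_cases_iff)
      ultimately show "card {j. j < n \<and> (0, j) \<notin> insert d D \<union> insert s S} = k"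
        using Suc.prems(5) ai(3) by simp
    qed (use Suc.prems ai d in \<open>auto simp: d_def unclaimed_def verts_grid less_2_cases_iff\<close>)
    ultimately show ?thesis using d by (auto simp: staller_has_won_def)
  qed
  ultimately show ?case by simp
qed

theorem theorem4:
  fixes n :: nat
  assumes "n \<ge> 1"
  shows "gamma_MB' (cartesian_product (path_graph 2) (path_graph n)) = enat n"
proof (rule antisym)
  have "dominator_forces (grid n) n {} {}" by (rule pairing_forces) auto
  then show "gamma_MB' (grid n) \<le> enat n"
    unfolding gamma_MB'_def by (intro Inf_lower) blast
next
  \<comment> \<open>At column 0 nothing lies behind the front, so the shield condition is
    vacuous.\<close>
  have "delays (grid n) n {} {}"
    using delays_grid[of 0 0 1 "{}" "{}"] by (simp add: grid_front_def)
  then have "\<not> dominator_forces (grid n) k {} {}" if "k < n" for k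
    using that delays_antimono[of _ n "{}" "{}" "Suc k"] by (intro delays_not_forces) auto
  then show "enat n \<le> gamma_MB' (grid n)"
    unfolding gamma_MB'_def by (intro Inf_greatest) (auto simp: not_less[symmetric])
qed

end
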